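(* Suppose that $\mathbf{Q}$ is diagonal with diagonal elements $q_i>0$, that $\widetilde{\boldsymbol\beta}_{\mathbf l}=\mathbf{H}_{\mathbf l}'\widetilde{\boldsymbol\beta}$ for every $\mathbf l$, and that any submodel of the full model is allowed (the class of models under consideration is $\{M_{\mathbf l}:\mathbf l\in\{0,1\}^k\}$). Then the best predictive model is the median probability model $M_{\mathbf l^*}$, where $l^*_i=1$ if $p_i\ge \frac12$ and $l_i^*=0$ otherwise. In addition, suppose that one is in the independent conjugate normal prior case with $\sigma^2$ given, and that the prior probabilities of the models satisfy $$P(M_{\mathbf l})=\prod_{i=1}^k (p_i^0)^{l_i}(1-p_i^0)^{1-l_i},$$ where $p_i^0$ is the prior probability that variable $x_i$ is in the model. Then $$P(M_{\mathbf l}|\mathbf y)=\prod_{i=1}^k p_i^{l_i}(1-p_i)^{1-l_i}\qquad\text{for all }\mathbf l\in\{0,1\}^k,$$ where the $p_i$ are the posterior inclusion probabilities, and the median probability model is the model with highest posterior probability.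
   Context: Full model: $\mathbf y=\mathbf X\boldsymbol\beta+\boldsymbol\varepsilon$, with $\mathbf y\in\mathbb R^n$ observed, $\mathbf X$ an $n\times k$ ($k<n$) design matrix of full rank, $\boldsymbol\beta\in\mathbb R^k$ unknown, and $\boldsymbol\varepsilon$ having independent $N(0,\sigma^2)$ coordinates ($\sigma^2$ known or unknown). For an index $\mathbf l=(l_1,\dots,l_k)\in\{0,1\}^k$, the submodel is $M_{\mathbf l}:\ \mathbf y=\mathbf X_{\mathbf l}\boldsymbol\beta_{\mathbf l}+\boldsymbol\varepsilon$, where $\mathbf X_{\mathbf l}$ consists of the columns $i$ of $\mathbf X$ with $l_i=1$; $k_{\mathbf l}=\sum_i l_i$. Posterior inputs: for each model a posterior probability $p_{\mathbf l}=P(M_{\mathbf l}|\mathbf y)\ge 0$, with $\sum_{\mathbf l}p_{\mathbf l}=1$, and a posterior distribution $\pi_{\mathbf l}(\boldsymbol\beta_{\mathbf l},\sigma|\mathbf y)$, with posterior mean $\widetilde{\boldsymbol\beta}_{\mathbf l}\in\mathbb R^{k_{\mathbf l}}$ of $\boldsymbol\beta_{\mathbf l}$. (In the first part these inputs need not arise from a single coherent prior.) $\widetilde{\boldsymbol\beta}$ denotes the posterior mean of $\boldsymbol\beta$ in the full model $\mathbf l=(1,\dots,1)$. $\mathbf H_{\mathbf l}$ is the $k\times k_{\mathbf l}$ matrix whose $(i,j)$ entry is $1$ if $l_i=1$ and $j=\sum_{r=1}^i l_r$, and $0$ otherwise. Set $\bar{\boldsymbol\beta}=\sum_{\mathbf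 l}p_{\mathbf l}\mathbf H_{\mathbf l}\widetilde{\boldsymbol\beta}_{\mathbf l}$. Prediction: a future $y^*=\mathbf x^*\boldsymbol\beta+\varepsilon$ is predicted under squared error loss, by $\widehat y^*_{\mathbf l}=\mathbf x^*\mathbf H_{\mathbf l}\widetilde{\boldsymbol\beta}_{\mathbf l}$ if $M_{\mathbf l}$ is used; the random row vector $\mathbf x^*$ of future covariates has $\mathbf Q=\mathbf E[(\mathbf x^* )'(\mathbf x^* )]$ existing and positive definite. Define $$R(M_{\mathbf l})=(\mathbf H_{\mathbf l}\widetilde{\boldsymbol\beta}_{\mathbf l}-\bar{\boldsymbol\beta})'\mathbf Q(\mathbf H_{\mathbf l}\widetilde{\boldsymbol\beta}_{\mathbf l}-\bar{\boldsymbol\beta}).$$ The best predictive model is the model minimizing $R(M_{\mathbf l})$ (equivalently, minimizing the posterior expected predictive squared error loss, which differs from $R(M_{\mathbf l})$ by a constant not depending on $\mathbf l$). The posterior inclusion probability of variable $i$ is $p_i=\sum_{\mathbf l:\,l_i=1}p_{\mathbf l}$. Independent conjugate normal prior case with $\sigma^2$ given: $\mathbf X'\mathbf X$ is diagonal; $\sigma^2>0$ is a given number; $\boldsymbol\mu\in\mathbb R^k$ and a diagonal matrix $\boldsymbol\Lambda$ with positive diagonal entries are given; the prior on $\boldsymbol\beta$ in the full model is $\mathcal N_k(\boldsymbol\mu,\sigma^2\boldsymbol\Lambda)$ and the prior $\pi_{\mathbf l}$ on $\boldsymbol\beta_{\mathbf l}$ in $M_{\mathbf l}$ is $\mathcal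 N_{k_{\mathbf l}}(\mathbf H_{\mathbf l}'\boldsymbol\mu,\sigma^2\mathbf H_{\mathbf l}'\boldsymbol\Lambda\mathbf H_{\mathbf l})$; the posterior distributions are given by Bayes' theorem, and the posterior model probabilities by $$P(M_{\mathbf l}|\mathbf y)=\frac{P(M_{\mathbf l})m_{\mathbf l}(\mathbf y)}{\sum_{\mathbf l^*}P(M_{\mathbf l^*})m_{\mathbf l^*}(\mathbf y)},\qquad m_{\mathbf l}(\mathbf y)=\int \pi_{\mathbf l}(\boldsymbol\beta_{\mathbf l})f_{\mathbf l}(\mathbf y|\boldsymbol\beta_{\mathbf l},\sigma)\,d\boldsymbol\beta_{\mathbf l},$$ where $f_{\mathbf l}(\mathbf y|\boldsymbol\beta_{\mathbf l},\sigma)$ is the $\mathcal N_n(\mathbf X_{\mathbf l}\boldsymbol\beta_{\mathbf l},\sigma^2\mathbf I)$ density. *)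

theory Defs
  imports
    "HOL-Probability.Probability"
    "Jordan_Normal_Form.Gauss_Jordan_Elimination"
    "Jordan_Normal_Form.DL_Rank"
    "Jordan_Normal_Form.DL_Submatrix"
begin

text \<open>
  Vectors and matrices are those of \<open>Jordan_Normal_Form.Matrix\<close>, since the dimension of the
  submodels varies. Coordinates, variables and rows are numbered from \<open>0\<close>.
\<close>

unbundle no inner_syntax
unbundle no vec_syntax

definition models :: "nat \<Rightarrow> (nat \<Rightarrow> nat) set" where
  "models k = {..<k} \<rightarrow>\<^sub>E {0, 1}"

definition full_model :: "nat \<Rightarrow> nat \<Rightarrow> nat" where
  "full_model k = (\<lambda>i\<in>{..<k}. 1)"

definition msize :: "nat \<Rightarrow> (nat \<Rightarrow> nat) \<Rightarrow> nat" where
  "msize k l = (\<Sum>i<k. l i)"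

text \<open>The matrix \<open>H\<^sub>l\<close>; \<open>Suc j\<close> because columns are numbered from \<open>0\<close>.\<close>

definition Hmat :: "nat \<Rightarrow> (nat \<Rightarrow> nat) \<Rightarrow> real mat" where
  "Hmat k l = mat k (msize k l)
     (\<lambda>(i, j). if l i = 1 \<and> Suc j = (\<Sum>r\<le>i. l r) then 1 else 0)"

definition subdesign :: "real mat \<Rightarrow> (nat \<Rightarrow> nat) \<Rightarrow> real mat" where
  "subdesign X l = submatrix X UNIV {i. i < dim_col X \<and> l i = 1}"

definition pos_def_mat :: "nat \<Rightarrow> real mat \<Rightarrow> bool" where
  "pos_def_mat k A \<longleftrightarrow> A \<in> carrier_mat k k \<and> A\<^sup>T = A \<and>
     (\<forall>v\<in>carrier_vec k. v \<noteq> 0\<^sub>v k \<longrightarrow> v \<bullet> (A *\<^sub>v v) > 0)"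

text \<open>\<open>E[(x\<^sup>*)'(x\<^sup>*)]\<close> for a random row vector \<open>x\<^sup>*\<close> of length \<open>k\<close>.\<close>

definition second_moment :: "nat \<Rightarrow> 'w measure \<Rightarrow> ('w \<Rightarrow> real vec) \<Rightarrow> real mat" where
  "second_moment k P x = mat k k (\<lambda>(i, j). \<integral>\<omega>. x \<omega> $ i * x \<omega> $ j \<partial>P)"

text \<open>
  A distribution of \<open>(\<beta>\<^sub>l, \<sigma>)\<close> is a measure on pairs of a coordinate function
  on \<open>{..<d}\<close> (where \<open>d = msize k l\<close>) and a real number.
\<close>

definition beta_sigma_distr :: "nat \<Rightarrow> ((nat \<Rightarrow> real) \<times> real) measure \<Rightarrow> bool" where
  "beta_sigma_distr d \<pi> \<longleftrightarrow> prob_space \<pi> \<and>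
     sets \<pi> = sets ((\<Pi>\<^sub>M j\<in>{..<d}. (borel :: real measure)) \<Otimes>\<^sub>M (borel :: real measure)) \<and>
     (AE z in \<pi>. snd z > 0)"

definition has_beta_mean :: "nat \<Rightarrow> ((nat \<Rightarrow> real) \<times> real) measure \<Rightarrow> bool" where
  "has_beta_mean d \<pi> \<longleftrightarrow> (\<forall>j<d. integrable \<pi> (\<lambda>z. fst z j))"

definition beta_mean :: "nat \<Rightarrow> ((nat \<Rightarrow> real) \<times> real) measure \<Rightarrow> real vec" where
  "beta_mean d \<pi> = vec d (\<lambda>j. \<integral>z. fst z j \<partial>\<pi>)"

definition beta_tilde ::
  "nat \<Rightarrow> ((nat \<Rightarrow> nat) \<Rightarrow> ((nat \<Rightarrow> real) \<times> real) measure) \<Rightarrow> (nat \<Rightarrow> nat) \<Rightarrow> real vec" where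
  "beta_tilde k \<pi> l = beta_mean (msize k l) (\<pi> l)"

definition beta_bar ::
  "nat \<Rightarrow> ((nat \<Rightarrow> nat) \<Rightarrow> real) \<Rightarrow> ((nat \<Rightarrow> nat) \<Rightarrow> ((nat \<Rightarrow> real) \<times> real) measure) \<Rightarrow> real vec" where
  "beta_bar k p \<pi> =
     vec k (\<lambda>i. \<Sum>l\<in>models k. p l * (Hmat k l *\<^sub>v beta_tilde k \<pi> l) $ i)"

definition risk ::
  "nat \<Rightarrow> ((nat \<Rightarrow> nat) \<Rightarrow> real) \<Rightarrow> ((nat \<Rightarrow> nat) \<Rightarrow> ((nat \<Rightarrow> real) \<times> real) measure) \<Rightarrow>
     real mat \<Rightarrow> (nat \<Rightarrow> nat) \<Rightarrow> real" where
  "risk k p \<pi> Q l =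
     (let v = Hmat k l *\<^sub>v beta_tilde k \<pi> l - beta_bar k p \<pi> in v \<bullet> (Q *\<^sub>v v))"

definition model_probs :: "nat \<Rightarrow> ((nat \<Rightarrow> nat) \<Rightarrow> real) \<Rightarrow> bool" where
  "model_probs k p \<longleftrightarrow> (\<forall>l\<in>models k. 0 \<le> p l) \<and> (\<Sum>l\<in>models k. p l) = 1"

text \<open>Used both for prior and for posterior model probabilities.\<close>

definition incl_prob :: "nat \<Rightarrow> ((nat \<Rightarrow> nat) \<Rightarrow> real) \<Rightarrow> nat \<Rightarrow> real" where
  "incl_prob k p i = (\<Sum>l | l \<in> models k \<and> l i = 1. p l)"

definition median_model :: "nat \<Rightarrow> ((nat \<Rightarrow> nat) \<Rightarrow> real) \<Rightarrow> nat \<Rightarrow> nat" where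
  "median_model k p = (\<lambda>i\<in>{..<k}. if incl_prob k p i \<ge> 1 / 2 then 1 else 0)"

definition mvn_density :: "nat \<Rightarrow> real vec \<Rightarrow> real mat \<Rightarrow> real vec \<Rightarrow> real" where
  "mvn_density d m S x =
     exp (- ((x - m) \<bullet> (the (mat_inverse S) *\<^sub>v (x - m))) / 2) / sqrt ((2 * pi) ^ d * det S)"

text \<open>The prior on \<open>\<beta>\<^sub>l\<close> is \<open>N(H\<^sub>l' \<mu>, \<sigma>\<^sup>2 H\<^sub>l' \<Lambda> H\<^sub>l)\<close>; for the full model \<open>H\<^sub>l\<close> is the identity.\<close>

definition conj_prior ::
  "nat \<Rightarrow> real vec \<Rightarrow> real mat \<Rightarrow> real \<Rightarrow> (nat \<Rightarrow> nat) \<Rightarrow> real vec \<Rightarrow> real" where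
  "conj_prior k \<mu> \<Lambda> \<sigma> l =
     mvn_density (msize k l) ((Hmat k l)\<^sup>T *\<^sub>v \<mu>) (\<sigma>\<^sup>2 \<cdot>\<^sub>m ((Hmat k l)\<^sup>T * \<Lambda> * Hmat k l))"

definition likelihood ::
  "real mat \<Rightarrow> real vec \<Rightarrow> real \<Rightarrow> (nat \<Rightarrow> nat) \<Rightarrow> real vec \<Rightarrow> real" where
  "likelihood X y \<sigma> l b =
     mvn_density (dim_row X) (subdesign X l *\<^sub>v b) (\<sigma>\<^sup>2 \<cdot>\<^sub>m 1\<^sub>m (dim_row X)) y"

definition marginal ::
  "nat \<Rightarrow> real mat \<Rightarrow> real vec \<Rightarrow> real vec \<Rightarrow> real mat \<Rightarrow> real \<Rightarrow> (nat \<Rightarrow> nat) \<Rightarrow> real" where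
  "marginal k X y \<mu> \<Lambda> \<sigma> l =
     (\<integral>b. conj_prior k \<mu> \<Lambda> \<sigma> l (vec (msize k l) b) * likelihood X y \<sigma> l (vec (msize k l) b)
        \<partial>(\<Pi>\<^sub>M j\<in>{..<msize k l}. lborel))"

text \<open>Bayes' theorem; as \<open>\<sigma>\<close> is given, its posterior is the point mass at \<open>\<sigma>\<close>.\<close>

definition conj_posterior ::
  "nat \<Rightarrow> real mat \<Rightarrow> real vec \<Rightarrow> real vec \<Rightarrow> real mat \<Rightarrow> real \<Rightarrow> (nat \<Rightarrow> nat) \<Rightarrow>
     ((nat \<Rightarrow> real) \<times> real) measure" where
  "conj_posterior k X y \<mu> \<Lambda> \<sigma> l =
     density (\<Pi>\<^sub>M j\<in>{..<msize k l}. lborel)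
       (\<lambda>b. ennreal (conj_prior k \<mu> \<Lambda> \<sigma> l (vec (msize k l) b) *
          likelihood X y \<sigma> l (vec (msize k l) b) / marginal k X y \<mu> \<Lambda> \<sigma> l))
     \<Otimes>\<^sub>M return borel \<sigma>"

definition model_posterior ::
  "nat \<Rightarrow> real mat \<Rightarrow> real vec \<Rightarrow> real vec \<Rightarrow> real mat \<Rightarrow> real \<Rightarrow> ((nat \<Rightarrow> nat) \<Rightarrow> real) \<Rightarrow>
     (nat \<Rightarrow> nat) \<Rightarrow> real" where
  "model_posterior k X y \<mu> \<Lambda> \<sigma> prior l =
     prior l * marginal k X y \<mu> \<Lambda> \<sigma> l /
     (\<Sum>l'\<in>models k. prior l' * marginal k X y \<mu> \<Lambda> \<sigma> l')"

definition indep_conj_case ::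
  "nat \<Rightarrow> real mat \<Rightarrow> real vec \<Rightarrow> real vec \<Rightarrow> real mat \<Rightarrow> real \<Rightarrow> ((nat \<Rightarrow> nat) \<Rightarrow> real) \<Rightarrow>
     ((nat \<Rightarrow> nat) \<Rightarrow> real) \<Rightarrow> ((nat \<Rightarrow> nat) \<Rightarrow> ((nat \<Rightarrow> real) \<times> real) measure) \<Rightarrow> bool" where
  "indep_conj_case k X y \<mu> \<Lambda> \<sigma> prior p \<pi> \<longleftrightarrow>
     diagonal_mat (X\<^sup>T * X) \<and> \<sigma> > 0 \<and> \<mu> \<in> carrier_vec k \<and>
     \<Lambda> \<in> carrier_mat k k \<and> diagonal_mat \<Lambda> \<and> (\<forall>i<k. \<Lambda> $$ (i, i) > 0) \<and>
     model_probs k prior \<and>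
     (\<forall>l\<in>models k. \<pi> l = conj_posterior k X y \<mu> \<Lambda> \<sigma> l \<and>
        p l = model_posterior k X y \<mu> \<Lambda> \<sigma> prior l)"

end

theory Submission
  imports Defs
begin

text \<open>
  Both assertions hold because everything splits over the variables.

  \<^bold>\<open>Prediction.\<close> Restricting a coefficient vector \<open>b\<close> to the variables of a model \<open>l\<close> and
  embedding it back multiplies coordinate \<open>i\<close> by \<open>l i\<close>. As each \<open>\<beta>\<^sub>l\<close> estimate is a restriction
  of the full estimate \<open>b\<close>, model averaging multiplies coordinate \<open>i\<close> by the inclusion
  probability \<open>p\<^sub>i\<close>. With a diagonal \<open>Q\<close> the risk of \<open>l\<close> is therefore
  \<open>\<Sum>i. q\<^sub>i * b\<^sub>i\<^sup>2 * (l i - p\<^sub>i)\<^sup>2\<close> (\<open>risk_eq_weighted_distance\<close>), and each summand is least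
  when \<open>l i\<close> is the element of \<open>{0, 1}\<close> nearest to \<open>p\<^sub>i\<close>.

  \<^bold>\<open>Posterior model probabilities.\<close> When the columns of \<open>X\<close> are orthogonal, the likelihood of a
  submodel is the likelihood of the model without variables times one factor for each included
  variable, and the prior density of its coefficients is a product as well. By Fubini the marginal
  likelihood is a constant times \<open>\<Prod>i. c\<^sub>i ^ l i\<close> (\<open>marginal_factorizes\<close>), where \<open>c\<^sub>i\<close> is the Bayes
  factor for adding variable \<open>i\<close>. Together with the product prior this shows that
  the posterior weights are proportional to a product over the variables. A probability
  distribution on \<open>{0, 1}\<^sup>k\<close> of that form is a product of Bernoulli distributions, whose
  parameters are its inclusion probabilities
  (\<open>normalized_product_weights_eq_incl_probs\<close>), and its mode is found one coordinate at a time.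
\<close>

section \<open>Product-form weights on the model space\<close>

lemma finite_models [simp]: "finite (models k)"
  by (simp add: models_def finite_PiE)

lemma models_cases:
  assumes "l \<in> models k" "i < k"
  shows "l i = 0 \<or> l i = 1"
  using assms by (auto simp: models_def PiE_iff)

lemma median_model_in_models: "median_model k p \<in> models k"
  by (auto simp: models_def median_model_def)

lemma sum_models_prod:
  fixes g :: "nat \<Rightarrow> nat \<Rightarrow> real"
  shows "(\<Sum>l\<in>models k. \<Prod>i<k. g i (l i)) = (\<Prod>i<k. g i 0 + g i 1)"
  unfolding models_def by (subst prod_sum_PiE [symmetric]) auto

text \<open>
  The indicator of \<open>l i = 1\<close> is \<open>l i\<close> itself; this makes inclusion probabilities linear functionals
  on a fixed index set, so that they can be exchanged with other sums over the models.
\<close>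

lemma incl_prob_eq_sum:
  assumes "i < k"
  shows "incl_prob k p i = (\<Sum>l\<in>models k. p l * real (l i))"
proof -
  have "(\<Sum>l\<in>models k. p l * real (l i)) = (\<Sum>l\<in>models k. if l i = 1 then p l else 0)"
    using models_cases [OF _ assms] by (intro sum.cong refl) force
  also have "\<dots> = incl_prob k p i"
    unfolding incl_prob_def by (simp add: sum.inter_filter)
  finally show ?thesis ..
qed

lemma incl_prob_bounds:
  assumes "model_probs k p"
  shows "0 \<le> incl_prob k p i" "incl_prob k p i \<le> 1"
proof -
  show "0 \<le> incl_prob k p i"
    using assms unfolding incl_prob_def model_probs_def by (intro sum_nonneg) auto
  have "incl_prob k p i \<le> (\<Sum>l\<in>models k. p l)"
    using assms unfolding incl_prob_def model_probs_def by (intro sum_mono2) auto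
  then show "incl_prob k p i \<le> 1"
    using assms by (simp add: model_probs_def)
qed

text \<open>
  The extra factor \<open>l j\<close> that selects the models containing \<open>j\<close> can be absorbed into the factor
  of coordinate \<open>j\<close>; the sum over all models then factorizes, and every coordinate other
  than \<open>j\<close> contributes \<open>1\<close>.
\<close>

lemma incl_prob_product:
  assumes p: "\<And>l. l \<in> models k \<Longrightarrow> p l = (\<Prod>i<k. g i (l i))"
    and g: "\<And>i. i < k \<Longrightarrow> g i 0 + g i 1 = (1::real)"
    and j: "j < k"
  shows "incl_prob k p j = g j 1"
proof -
  let ?h = "\<lambda>i v. if i = j then g i v * real v else g i v"
  have "incl_prob k p j = (\<Sum>l\<in>models k. \<Prod>i<k. ?h i (l i))"
    unfolding incl_prob_eq_sum [OF j]
  proof (intro sum.cong refl)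
    fix l assume l: "l \<in> models k"
    have "p l * real (l j) = (\<Prod>i<k. g i (l i)) * (\<Prod>i<k. if i = j then real (l i) else 1)"
      using p [OF l] j by simp
    also have "\<dots> = (\<Prod>i<k. ?h i (l i))"
      unfolding prod.distrib [symmetric] by (intro prod.cong) auto
    finally show "p l * real (l j) = (\<Prod>i<k. ?h i (l i))" .
  qed
  also have "\<dots> = (\<Prod>i<k. if i = j then g i 1 else 1)"
    unfolding sum_models_prod [of ?h k] using g by (intro prod.cong) auto
  also have "\<dots> = g j 1"
    using j by simp
  finally show ?thesis .
qed

text \<open>
  The total mass \<open>1\<close> forces \<open>K\<close> to be the inverse of \<open>\<Prod>i. h i 0 + h i 1\<close>. Dividing this constant
  up among the coordinates turns \<open>h i\<close> into a Bernoulli distribution, whose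
  value at \<open>1\<close> is the inclusion probability of \<open>i\<close>.
\<close>

lemma normalized_product_weights_eq_incl_probs:
  fixes h :: "nat \<Rightarrow> nat \<Rightarrow> real"
  assumes p: "\<And>l. l \<in> models k \<Longrightarrow> p l = K * (\<Prod>i<k. h i (l i))"
    and total: "(\<Sum>l\<in>models k. p l) = 1"
    and l: "l \<in> models k"
  shows "p l = (\<Prod>i<k. incl_prob k p i ^ l i * (1 - incl_prob k p i) ^ (1 - l i))"
proof -
  define s where "s i = h i 0 + h i 1" for i
  have "K * (\<Prod>i<k. s i) = 1"
    using total by (simp add: p sum_distrib_left [symmetric] sum_models_prod s_def)
  moreover from this have nz: "(\<Prod>i<k. s i) \<noteq> 0"
    by (metis mult_zero_right zero_neq_one)
  ultimately have K: "K = 1 / (\<Prod>i<k. s i)"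
    by (metis nonzero_eq_divide_eq)
  have s: "s i \<noteq> 0" if "i < k" for i
    using nz that by auto
  have p': "p l = (\<Prod>i<k. h i (l i) / s i)" if "l \<in> models k" for l
    using p [OF that] by (simp add: K prod_dividef)
  have norm: "h i 0 / s i + h i 1 / s i = 1" if "i < k" for i
    using s [OF that] by (simp add: s_def add_divide_distrib [symmetric])
  have incl: "incl_prob k p i = h i 1 / s i" if "i < k" for i
    using incl_prob_product [of k p "\<lambda>i v. h i v / s i"] p' norm that by blast
  show ?thesis
    unfolding p' [OF l]
  proof (intro prod.cong refl)
    fix i assume "i \<in> {..<k}"
    then have i: "i < k" by simp
    show "h i (l i) / s i = incl_prob k p i ^ l i * (1 - incl_prob k p i) ^ (1 - l i)"
      using models_cases [OF l i] incl [OF i] norm [OF i] by auto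
  qed
qed

text \<open>
  The factor of variable \<open>i\<close> is \<open>p\<^sub>i\<close> or \<open>1 - p\<^sub>i\<close>, both nonnegative; the threshold \<open>1 / 2\<close>
  picks the larger one.
\<close>

lemma median_model_maximizes_product_weights:
  assumes probs: "model_probs k p"
    and p: "\<And>l. l \<in> models k \<Longrightarrow>
      p l = (\<Prod>i<k. incl_prob k p i ^ l i * (1 - incl_prob k p i) ^ (1 - l i))"
  shows "is_arg_max p (\<lambda>l. l \<in> models k) (median_model k p)"
proof -
  have "p l \<le> p (median_model k p)" if l: "l \<in> models k" for l
    unfolding p [OF l] p [OF median_model_in_models]
  proof (intro prod_mono conjI)
    fix i assume "i \<in> {..<k}"
    then have i: "i < k" by simp
    note b = incl_prob_bounds [OF probs, of i]
    show "0 \<le> incl_prob k p i ^ l i * (1 - incl_prob k p i) ^ (1 - l i)"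
      using b by simp
    show "incl_prob k p i ^ l i * (1 - incl_prob k p i) ^ (1 - l i)
        \<le> incl_prob k p i ^ median_model k p i * (1 - incl_prob k p i) ^ (1 - median_model k p i)"
      using models_cases [OF l i] i by (auto simp: median_model_def)
  qed
  then show ?thesis
    by (auto simp: is_arg_max_def median_model_in_models not_less)
qed

section \<open>Selecting the variables of a submodel\<close>

abbreviation vars :: "nat \<Rightarrow> (nat \<Rightarrow> nat) \<Rightarrow> nat set" where
  "vars k l \<equiv> {i. i < k \<and> l i = 1}"

lemma msize_eq_card:
  assumes "l \<in> models k"
  shows "msize k l = card (vars k l)"
proof -
  have "msize k l = (\<Sum>i<k. if l i = 1 then 1 else 0)"
    unfolding msize_def using models_cases [OF assms] by (intro sum.cong refl) force
  also have "\<dots> = card {i \<in> {..<k}. l i = 1}"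
    by (subst card_eq_sum, subst sum.inter_filter) auto
  finally show ?thesis by simp
qed

lemma pick_vars:
  assumes l: "l \<in> models k" and j: "j < msize k l"
  shows "pick (vars k l) j < k" "l (pick (vars k l) j) = 1"
  using pick_in_set_le [of j "vars k l"] j by (auto simp: msize_eq_card [OF l])

text \<open>
  Coefficient \<open>j\<close> of a submodel belongs to variable \<open>pick (vars k l) j\<close>. This correspondence
  carries sums and products over the coefficients of \<open>l\<close> to the variables of the full model, where
  different models can be compared.
\<close>

lemma bij_betw_pick_vars:
  assumes l: "l \<in> models k"
  shows "bij_betw (pick (vars k l)) {..<msize k l} (vars k l)"
proof -
  have inj: "inj_on (pick (vars k l)) {..<msize k l}"
    by (rule inj_on_inverseI [where g = "\<lambda>i. card {a \<in> vars k l. a < i}"])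
      (use card_pick_le [of _ "vars k l"] in \<open>simp add: msize_eq_card [OF l]\<close>)
  moreover have "pick (vars k l) ` {..<msize k l} = vars k l"
    using pick_vars [OF l] card_image [OF inj] msize_eq_card [OF l]
    by (intro card_subset_eq) auto
  ultimately show ?thesis
    by (simp add: bij_betw_def)
qed

text \<open>
  For a variable \<open>i\<close> of the model, the column condition in the definition of \<open>Hmat\<close> says that \<open>i\<close> is preceded by exactly \<open>j\<close>
  variables of the model, which characterizes the \<open>j\<close>-th element of \<open>vars k l\<close>. In this form
  \<open>Hmat\<close> selects the same variables as \<open>subdesign\<close> does.
\<close>

lemma Hmat_index:
  assumes l: "l \<in> models k" and i: "i < k" and j: "j < msize k l"
  shows "Hmat k l $$ (i, j) = (if i = pick (vars k l) j then 1 else 0)"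
proof -
  have "(\<Sum>r\<le>i. l r) = (\<Sum>r\<le>i. if l r = 1 then 1 else 0)"
    using models_cases [OF l] i by (intro sum.cong refl) (metis atMost_iff le_less_trans zero_neq_one)
  also have "\<dots> = card {r \<in> {..i}. l r = 1}"
    by (subst card_eq_sum, subst sum.inter_filter) auto
  finally have rank: "(\<Sum>r\<le>i. l r) = card {r \<in> {..i}. l r = 1}" .
  have suc: "card {r \<in> {..i}. l r = 1} = Suc (card {a \<in> vars k l. a < i})" if "l i = 1"
  proof -
    have "{r \<in> {..i}. l r = 1} = insert i {a \<in> vars k l. a < i}"
      using that i by auto
    then show ?thesis by simp
  qed
  have "l i = 1 \<and> Suc j = (\<Sum>r\<le>i. l r) \<longleftrightarrow> i = pick (vars k l) j"
  proof
    assume "l i = 1 \<and> Suc j = (\<Sum>r\<le>i. l r)"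
    then show "i = pick (vars k l) j"
      using rank suc pick_card_in_set [of i "vars k l"] i by auto
  next
    assume "i = pick (vars k l) j"
    then show "l i = 1 \<and> Suc j = (\<Sum>r\<le>i. l r)"
      using rank suc pick_vars [OF l j] card_pick_le [of j "vars k l"] j
      by (auto simp: msize_eq_card [OF l])
  qed
  then show ?thesis
    using i j by (simp add: Hmat_def)
qed

lemma Hmat_carrier [simp]: "Hmat k l \<in> carrier_mat k (msize k l)"
  by (simp add: Hmat_def)

lemma Hmat_dim [simp]: "dim_row (Hmat k l) = k" "dim_col (Hmat k l) = msize k l"
  by (simp_all add: Hmat_def)

lemma Hmat_transpose_mult_vec_index:
  assumes l: "l \<in> models k" and v: "v \<in> carrier_vec k" and j: "j < msize k l"
  shows "((Hmat k l)\<^sup>T *\<^sub>v v) $ j = v $ pick (vars k l) j"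
  using v j pick_vars(1) [OF l j]
  by (simp add: scalar_prod_def Hmat_index [OF l] mult_delta_left)

lemma Hmat_embed_restrict_index:
  assumes l: "l \<in> models k" and v: "v \<in> carrier_vec k" and i: "i < k"
  shows "(Hmat k l *\<^sub>v ((Hmat k l)\<^sup>T *\<^sub>v v)) $ i = real (l i) * v $ i"
proof -
  have "(Hmat k l *\<^sub>v ((Hmat k l)\<^sup>T *\<^sub>v v)) $ i =
      (\<Sum>j=0..<msize k l. Hmat k l $$ (i, j) * ((Hmat k l)\<^sup>T *\<^sub>v v) $ j)"
    using i by (simp add: scalar_prod_def)
  also have "\<dots> = (\<Sum>j=0..<msize k l. if pick (vars k l) j = i then v $ i else 0)"
    using i by (auto simp: Hmat_transpose_mult_vec_index [OF l v] Hmat_index [OF l]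
        simp del: index_mult_mat_vec intro!: sum.cong)
  also have "\<dots> = (\<Sum>a\<in>vars k l. if a = i then v $ i else 0)"
    using sum.reindex_bij_betw [OF bij_betw_pick_vars [OF l], of "\<lambda>a. if a = i then v $ i else 0"]
    by (simp add: lessThan_atLeast0)
  also have "\<dots> = real (l i) * v $ i"
    using models_cases [OF l i] i by auto
  finally show ?thesis .
qed

text \<open>
  The scale matrix of the prior in a submodel is the principal submatrix of \<open>\<Lambda>\<close> on its variables;
  in particular it inherits diagonality and positivity.
\<close>

lemma Hmat_congruence_index:
  assumes l: "l \<in> models k" and L: "\<Lambda> \<in> carrier_mat k k"
    and j: "j < msize k l" and j': "j' < msize k l"
  shows "((Hmat k l)\<^sup>T * \<Lambda> * Hmat k l) $$ (j, j') = \<Lambda> $$ (pick (vars k l) j, pick (vars k l) j')"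
proof -
  let ?a = "pick (vars k l) j" and ?b = "pick (vars k l) j'"
  have row: "((Hmat k l)\<^sup>T * \<Lambda>) $$ (j, b) = \<Lambda> $$ (?a, b)" if "b < k" for b
    using L j that pick_vars(1) [OF l j]
    by (simp add: scalar_prod_def Hmat_index [OF l] mult_delta_left)
  have "((Hmat k l)\<^sup>T * \<Lambda> * Hmat k l) $$ (j, j') =
      (\<Sum>b=0..<k. ((Hmat k l)\<^sup>T * \<Lambda>) $$ (j, b) * Hmat k l $$ (b, j'))"
    using L j j' by (subst index_mult_mat(1)) (auto simp: scalar_prod_def intro!: sum.cong)
  also have "\<dots> = (\<Sum>b=0..<k. if b = ?b then \<Lambda> $$ (?a, b) else 0)"
    by (intro sum.cong refl) (auto simp: row Hmat_index [OF l _ j'] simp del: index_mult_mat)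
  finally show ?thesis
    using pick_vars(1) [OF l j'] by simp
qed

lemma subdesign_index:
  assumes X: "X \<in> carrier_mat n k" and l: "l \<in> models k"
    and s: "s < n" and j: "j < msize k l"
  shows "subdesign X l $$ (s, j) = X $$ (s, pick (vars k l) j)"
  using assms unfolding subdesign_def
  by (subst submatrix_index) (auto simp: pick_UNIV msize_eq_card)

lemma subdesign_carrier:
  assumes "X \<in> carrier_mat n k" "l \<in> models k"
  shows "subdesign X l \<in> carrier_mat n (msize k l)"
  using assms unfolding subdesign_def
  by (auto simp: dim_submatrix msize_eq_card intro!: carrier_matI)

section \<open>The predictive risk\<close>

lemma diagonal_quadratic_form:
  fixes Q :: "'a :: comm_semiring_1 mat"
  assumes Q: "Q \<in> carrier_mat k k" "diagonal_mat Q" and v: "v \<in> carrier_vec k"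
  shows "v \<bullet> (Q *\<^sub>v v) = (\<Sum>i<k. Q $$ (i, i) * (v $ i)\<^sup>2)"
proof -
  have "(Q *\<^sub>v v) $ i = Q $$ (i, i) * v $ i" if i: "i < k" for i
  proof -
    have "(Q *\<^sub>v v) $ i = (\<Sum>j=0..<k. Q $$ (i, j) * v $ j)"
      using Q v i by (simp add: scalar_prod_def)
    also have "\<dots> = (\<Sum>j=0..<k. if j = i then Q $$ (i, i) * v $ i else 0)"
      using Q i by (intro sum.cong) (auto simp: diagonal_mat_def)
    finally show ?thesis using i by simp
  qed
  then have "v \<bullet> (Q *\<^sub>v v) = (\<Sum>i=0..<k. v $ i * (Q $$ (i, i) * v $ i))"
    using Q v by (simp add: scalar_prod_def del: index_mult_mat_vec)
  then show ?thesis
    by (simp add: lessThan_atLeast0 power2_eq_square mult.left_commute)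
qed

text \<open>
  In coordinate \<open>i\<close> the embedded estimate of model \<open>l\<close> is \<open>l i * b\<^sub>i\<close> and the model average is
  \<open>p\<^sub>i * b\<^sub>i\<close>, so their difference is a multiple of \<open>b\<^sub>i\<close> and a diagonal \<open>Q\<close> has no cross terms.
\<close>

lemma risk_eq_weighted_distance:
  assumes Q: "Q \<in> carrier_mat k k" "diagonal_mat Q"
    and restrict: "\<And>l. l \<in> models k \<Longrightarrow> beta_tilde k \<pi> l = (Hmat k l)\<^sup>T *\<^sub>v b"
    and b: "b \<in> carrier_vec k"
    and l: "l \<in> models k"
  shows "risk k p \<pi> Q l = (\<Sum>i<k. Q $$ (i, i) * (b $ i)\<^sup>2 * (real (l i) - incl_prob k p i)\<^sup>2)"
proof -
  let ?v = "Hmat k l *\<^sub>v beta_tilde k \<pi> l - beta_bar k p \<pi>"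
  have bar: "beta_bar k p \<pi> $ i = incl_prob k p i * b $ i" if i: "i < k" for i
  proof -
    have "beta_bar k p \<pi> $ i = (\<Sum>l\<in>models k. p l * (real (l i) * b $ i))"
      using i by (auto simp: beta_bar_def restrict Hmat_embed_restrict_index [OF _ b]
          simp del: index_mult_mat_vec intro!: sum.cong)
    then show ?thesis
      by (simp add: incl_prob_eq_sum [OF i] sum_distrib_right mult.assoc)
  qed
  have bar_dim: "beta_bar k p \<pi> \<in> carrier_vec k"
    by (simp add: beta_bar_def)
  have v: "?v \<in> carrier_vec k"
    using bar_dim by (intro minus_carrier_vec) (auto intro: carrier_vecI)
  have "?v $ i = b $ i * (real (l i) - incl_prob k p i)" if i: "i < k" for i
    using i bar_dim by (simp add: restrict [OF l] Hmat_embed_restrict_index [OF l b] bar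
        algebra_simps del: index_mult_mat_vec)
  then show ?thesis
    unfolding risk_def Let_def diagonal_quadratic_form [OF Q v]
    by (intro sum.cong) (auto simp: power_mult_distrib mult.assoc)
qed

text \<open>
  For \<open>l i \<in> {0, 1}\<close> the two possible values of \<open>(l i - p\<^sub>i)\<^sup>2\<close> differ by \<open>1 - 2 * p\<^sub>i\<close>, so the threshold
  \<open>1 / 2\<close> picks the smaller one; as the weights are nonnegative, this minimizes the sum.
\<close>

lemma median_model_minimizes_risk:
  assumes Q: "Q \<in> carrier_mat k k" "diagonal_mat Q" "\<And>i. i < k \<Longrightarrow> 0 \<le> Q $$ (i, i)"
    and restrict: "\<And>l. l \<in> models k \<Longrightarrow> beta_tilde k \<pi> l = (Hmat k l)\<^sup>T *\<^sub>v b"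
    and b: "b \<in> carrier_vec k"
  shows "is_arg_min (risk k p \<pi> Q) (\<lambda>l. l \<in> models k) (median_model k p)"
proof -
  have risk: "risk k p \<pi> Q l = (\<Sum>i<k. Q $$ (i, i) * (b $ i)\<^sup>2 * (real (l i) - incl_prob k p i)\<^sup>2)"
    if "l \<in> models k" for l
    using Q(1,2) restrict b that by (rule risk_eq_weighted_distance)
  have "risk k p \<pi> Q (median_model k p) \<le> risk k p \<pi> Q l" if l: "l \<in> models k" for l
    unfolding risk [OF l] risk [OF median_model_in_models]
  proof (intro sum_mono mult_left_mono)
    fix i assume "i \<in> {..<k}"
    then have i: "i < k" by simp
    show "(real (median_model k p i) - incl_prob k p i)\<^sup>2 \<le> (real (l i) - incl_prob k p i)\<^sup>2"
      using models_cases [OF l i] i by (auto simp: median_model_def power2_eq_square algebra_simps)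
    show "0 \<le> Q $$ (i, i) * (b $ i)\<^sup>2"
      using Q(3) [OF i] by simp
  qed
  then show ?thesis
    by (auto simp: is_arg_min_def median_model_in_models not_less)
qed

section \<open>Gaussian densities with diagonal covariance\<close>

lemma mat_inverse_diagonal:
  fixes S :: "'a :: field mat"
  assumes S: "S \<in> carrier_mat d d" "diagonal_mat S" "\<And>i. i < d \<Longrightarrow> S $$ (i, i) \<noteq> 0"
  shows "mat_inverse S = Some (mat d d (\<lambda>(i, j). if i = j then 1 / S $$ (i, i) else 0))"
proof -
  define D where "D = mat d d (\<lambda>(i, j). if i = j then 1 / S $$ (i, i) else 0)"
  have D: "D \<in> carrier_mat d d"
    by (simp add: D_def)
  have SD: "S * D = 1\<^sub>m d"
  proof (rule eq_matI)
    fix i j assume ij: "i < dim_row (1\<^sub>m d)" "j < dim_col (1\<^sub>m d)"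
    then have "(S * D) $$ (i, j) = (\<Sum>m=0..<d. S $$ (i, m) * D $$ (m, j))"
      using S D by (simp add: scalar_prod_def)
    also have "\<dots> = (\<Sum>m=0..<d. if m = i then (if i = j then 1 else 0) else 0)"
      using S ij by (intro sum.cong) (auto simp: D_def diagonal_mat_def)
    finally show "(S * D) $$ (i, j) = 1\<^sub>m d $$ (i, j)"
      using ij by simp
  qed (use S D in auto)
  have DS: "D * S = 1\<^sub>m d"
    using mat_mult_left_right_inverse [OF S(1) D SD] .
  have "S \<in> Units (ring_mat TYPE('a) d ())"
    using S(1) D SD DS by (auto simp: Units_def ring_mat_def)
  then obtain B where B: "mat_inverse S = Some B"
    using mat_inverse(1) [OF S(1), where b = "()"] by (cases "mat_inverse S") auto
  (* a right inverse D and a two-sided inverse B coincide *)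
  have "B = B * (S * D)"
    using mat_inverse(2) [OF S(1) B] by (auto simp: SD)
  also have "\<dots> = (B * S) * D"
    using mat_inverse(2) [OF S(1) B] S(1) D by (intro assoc_mult_mat [symmetric]) auto
  also have "\<dots> = D"
    using mat_inverse(2) [OF S(1) B] D by simp
  finally show ?thesis
    using B by (simp add: D_def)
qed

lemma det_diagonal:
  fixes S :: "'a :: comm_ring_1 mat"
  assumes "S \<in> carrier_mat d d" "diagonal_mat S"
  shows "det S = (\<Prod>i<d. S $$ (i, i))"
  using assms det_upper_triangular [of S d]
  by (force simp: diagonal_mat_def prod_list_diag_prod lessThan_atLeast0)

text \<open>
  A diagonal covariance is inverted entrywise and its determinant is a product, so the density
  is that of independent normal coordinates; in this form Fubini's theorem applies to it.
\<close>

lemma mvn_density_diagonal: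
  assumes m: "m \<in> carrier_vec d" and x: "x \<in> carrier_vec d"
    and S: "S \<in> carrier_mat d d" "diagonal_mat S" "\<And>i. i < d \<Longrightarrow> 0 < S $$ (i, i)"
  shows "mvn_density d m S x = (\<Prod>i<d. normal_density (m $ i) (sqrt (S $$ (i, i))) (x $ i))"
proof -
  let ?D = "mat d d (\<lambda>(i, j). if i = j then 1 / S $$ (i, i) else 0)"
  have "mat_inverse S = Some ?D"
    using S by (intro mat_inverse_diagonal) force+
  moreover have "(x - m) \<bullet> (?D *\<^sub>v (x - m)) = (\<Sum>i<d. (x $ i - m $ i)\<^sup>2 / S $$ (i, i))"
    using m x by (subst diagonal_quadratic_form) (auto simp: diagonal_mat_def intro!: sum.cong)
  ultimately have "mvn_density d m S x =
      (\<Prod>i<d. exp (- ((x $ i - m $ i)\<^sup>2 / S $$ (i, i)) / 2)) / sqrt (\<Prod>i<d. 2 * pi * S $$ (i, i))"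
    by (simp add: mvn_density_def det_diagonal [OF S(1,2)] prod.distrib exp_sum [symmetric]
        sum_negf sum_divide_distrib)
  also have "sqrt (\<Prod>i<d. 2 * pi * S $$ (i, i)) = (\<Prod>i<d. sqrt (2 * pi * S $$ (i, i)))"
    by (induction d) (simp_all add: real_sqrt_mult)
  also have "(\<Prod>i<d. exp (- ((x $ i - m $ i)\<^sup>2 / S $$ (i, i)) / 2)) / \<dots> =
      (\<Prod>i<d. normal_density (m $ i) (sqrt (S $$ (i, i))) (x $ i))"
    using S(3) by (auto simp: prod_dividef [symmetric] normal_density_def less_imp_le
        mult.commute intro!: prod.cong)
  finally show ?thesis .
qed

section \<open>Factorization of the marginal likelihood\<close>

text \<open>
  Relative to the density with mean \<open>0\<close>, the likelihood is the exponential of the reduction of the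
  residual sum of squares. By orthogonality of the regressors this reduction is the sum of the
  reductions that each regressor achieves alone. Writing it as a difference of two sums of squares
  makes it visibly bounded in \<open>b\<close>, which gives integrability below.
\<close>

lemma orthogonal_regression_likelihood:
  fixes u :: "nat \<Rightarrow> nat \<Rightarrow> real" and y b :: "nat \<Rightarrow> real"
  assumes orth: "\<And>i j. i < d \<Longrightarrow> j < d \<Longrightarrow> i \<noteq> j \<Longrightarrow> (\<Sum>s<n. u s i * u s j) = 0"
  shows "(\<Prod>s<n. normal_density (\<Sum>j<d. u s j * b j) \<sigma> (y s)) =
    (\<Prod>s<n. normal_density 0 \<sigma> (y s)) *
    (\<Prod>j<d. exp (((\<Sum>s<n. (y s)\<^sup>2) - (\<Sum>s<n. (y s - u s j * b j)\<^sup>2)) / (2 * \<sigma>\<^sup>2)))"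
proof -
  let ?f = "\<lambda>s. \<Sum>j<d. u s j * b j"
  have cross: "(\<Sum>s<n. (?f s)\<^sup>2) = (\<Sum>j<d. \<Sum>s<n. (u s j * b j)\<^sup>2)"
  proof -
    have "(\<Sum>s<n. (?f s)\<^sup>2) = (\<Sum>s<n. \<Sum>i<d. \<Sum>j<d. (u s i * b i) * (u s j * b j))"
      by (simp add: power2_eq_square sum_product)
    also have "\<dots> = (\<Sum>i<d. \<Sum>j<d. \<Sum>s<n. (u s i * b i) * (u s j * b j))"
      by (subst sum.swap) (simp add: sum.swap [of _ "{..<n}"])
    also have "\<dots> = (\<Sum>i<d. \<Sum>j<d. b i * b j * (\<Sum>s<n. u s i * u s j))"
      by (simp add: sum_distrib_left mult_ac)
    also have "\<dots> = (\<Sum>i<d. \<Sum>j<d. if j = i then b i * b i * (\<Sum>s<n. u s i * u s i) else 0)"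
      using orth by (intro sum.cong refl) auto
    also have "\<dots> = (\<Sum>i<d. \<Sum>s<n. (u s i * b i)\<^sup>2)"
      by (simp add: sum_distrib_left power2_eq_square mult_ac)
    finally show ?thesis .
  qed
  have "(\<Sum>s<n. (y s)\<^sup>2) - (\<Sum>s<n. (y s - ?f s)\<^sup>2) = 2 * (\<Sum>s<n. y s * ?f s) - (\<Sum>s<n. (?f s)\<^sup>2)"
    by (simp add: power2_diff sum.distrib sum_subtractf sum_distrib_left algebra_simps)
  also have "\<dots> = (\<Sum>j<d. 2 * (\<Sum>s<n. y s * (u s j * b j)) - (\<Sum>s<n. (u s j * b j)\<^sup>2))"
    unfolding cross sum_subtractf sum_distrib_left by (subst sum.swap) simp
  also have "\<dots> = (\<Sum>j<d. (\<Sum>s<n. (y s)\<^sup>2) - (\<Sum>s<n. (y s - u s j * b j)\<^sup>2))"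
    by (simp add: power2_diff sum.distrib sum_subtractf sum_distrib_left algebra_simps)
  finally have expand: "(\<Sum>s<n. (y s)\<^sup>2) - (\<Sum>s<n. (y s - ?f s)\<^sup>2) =
      (\<Sum>j<d. (\<Sum>s<n. (y s)\<^sup>2) - (\<Sum>s<n. (y s - u s j * b j)\<^sup>2))" .
  have "(\<Prod>s<n. normal_density (?f s) \<sigma> (y s)) =
      (\<Prod>s<n. normal_density 0 \<sigma> (y s) * exp (((y s)\<^sup>2 - (y s - ?f s)\<^sup>2) / (2 * \<sigma>\<^sup>2)))"
    by (intro prod.cong refl) (simp add: normal_density_def exp_add [symmetric] diff_divide_distrib)
  also have "\<dots> = (\<Prod>s<n. normal_density 0 \<sigma> (y s)) *
      exp (((\<Sum>s<n. (y s)\<^sup>2) - (\<Sum>s<n. (y s - ?f s)\<^sup>2)) / (2 * \<sigma>\<^sup>2))"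
    by (simp add: prod.distrib exp_sum [symmetric] sum_divide_distrib [symmetric] sum_subtractf)
  finally show ?thesis
    unfolding expand sum_divide_distrib exp_sum [OF finite_lessThan] .
qed

text \<open>
  The ratio of the marginal likelihood of the model with the single variable \<open>i\<close> to that of the
  model without variables. For orthogonal columns the ratio is the same when \<open>i\<close> is added to
  any other model not containing it.
\<close>

definition bayes_factor ::
  "nat \<Rightarrow> real mat \<Rightarrow> real vec \<Rightarrow> real vec \<Rightarrow> real mat \<Rightarrow> real \<Rightarrow> nat \<Rightarrow> real" where
  "bayes_factor n X y \<mu> \<Lambda> \<sigma> i =
     (\<integral>t. normal_density (\<mu> $ i) (sqrt (\<sigma>\<^sup>2 * \<Lambda> $$ (i, i))) t *
        exp (((\<Sum>s<n. (y $ s)\<^sup>2) - (\<Sum>s<n. (y $ s - X $$ (s, i) * t)\<^sup>2)) / (2 * \<sigma>\<^sup>2)) \<partial>lborel)"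

text \<open>
  The exponential is bounded by its value at a perfect fit, so integrability is inherited from
  the normal density; the regressor \<open>a\<close> may even vanish.
\<close>

lemma integrable_normal_density_times_likelihood_ratio:
  assumes "\<tau> > 0"
  shows "integrable lborel (\<lambda>t. normal_density m \<tau> t *
     exp (((\<Sum>s<n. (y s)\<^sup>2) - (\<Sum>s<n. (y s - a s * t)\<^sup>2)) / (2 * \<sigma>\<^sup>2)))"
proof (rule Bochner_Integration.integrable_bound)
  let ?C = "exp ((\<Sum>s<n. (y s)\<^sup>2) / (2 * \<sigma>\<^sup>2))"
  show "integrable lborel (\<lambda>t. normal_density m \<tau> t * ?C)"
    using assms by simp
  have "exp (((\<Sum>s<n. (y s)\<^sup>2) - (\<Sum>s<n. (y s - a s * t)\<^sup>2)) / (2 * \<sigma>\<^sup>2)) \<le> ?C" for t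
    by (auto intro!: divide_right_mono sum_nonneg)
  then show "AE t in lborel. norm (normal_density m \<tau> t *
      exp (((\<Sum>s<n. (y s)\<^sup>2) - (\<Sum>s<n. (y s - a s * t)\<^sup>2)) / (2 * \<sigma>\<^sup>2)))
      \<le> norm (normal_density m \<tau> t * ?C)"
    by (auto simp: abs_mult intro!: mult_left_mono)
qed measurable

lemma conj_prior_eq:
  assumes l: "l \<in> models k" and \<mu>: "\<mu> \<in> carrier_vec k" and \<sigma>: "\<sigma> > 0"
    and \<Lambda>: "\<Lambda> \<in> carrier_mat k k" "diagonal_mat \<Lambda>" "\<forall>i<k. \<Lambda> $$ (i, i) > 0"
  shows "conj_prior k \<mu> \<Lambda> \<sigma> l (vec (msize k l) b) =
    (\<Prod>j<msize k l. normal_density (\<mu> $ pick (vars k l) j)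
       (sqrt (\<sigma>\<^sup>2 * \<Lambda> $$ (pick (vars k l) j, pick (vars k l) j))) (b j))"
proof -
  let ?S = "\<sigma>\<^sup>2 \<cdot>\<^sub>m ((Hmat k l)\<^sup>T * \<Lambda> * Hmat k l)"
  have S: "?S \<in> carrier_mat (msize k l) (msize k l)"
    using \<Lambda>(1) by (auto intro!: carrier_matI)
  have idx: "?S $$ (i, j) = \<sigma>\<^sup>2 * \<Lambda> $$ (pick (vars k l) i, pick (vars k l) j)"
    if "i < msize k l" "j < msize k l" for i j
    using S that Hmat_congruence_index [OF l \<Lambda>(1) that] by (simp del: index_mult_mat(1))
  have "diagonal_mat ?S"
    unfolding diagonal_mat_def
  proof (intro allI impI)
    fix i j assume ij: "i < dim_row ?S" "j < dim_col ?S" "i \<noteq> j"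
    then have ij': "i < msize k l" "j < msize k l"
      using S by auto
    then have "pick (vars k l) i \<noteq> pick (vars k l) j"
      using bij_betw_pick_vars [OF l] ij(3) by (auto simp: bij_betw_def inj_on_def)
    then show "?S $$ (i, j) = 0"
      using idx [OF ij'] \<Lambda>(1,2) pick_vars(1) [OF l] ij' by (auto simp: diagonal_mat_def)
  qed
  then show ?thesis
    unfolding conj_prior_def using S idx \<sigma> \<Lambda>(3) pick_vars(1) [OF l]
    by (subst mvn_density_diagonal)
      (auto simp: Hmat_transpose_mult_vec_index [OF l \<mu>]
        simp del: index_mult_mat_vec index_smult_mat intro!: prod.cong carrier_vecI)
qed

lemma likelihood_eq:
  assumes X: "X \<in> carrier_mat n k" and y: "y \<in> carrier_vec n"
    and orth: "diagonal_mat (X\<^sup>T * X)"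
    and l: "l \<in> models k" and \<sigma>: "\<sigma> > 0"
  shows "likelihood X y \<sigma> l (vec (msize k l) b) =
    (\<Prod>s<n. normal_density 0 \<sigma> (y $ s)) *
    (\<Prod>j<msize k l. exp (((\<Sum>s<n. (y $ s)\<^sup>2) -
       (\<Sum>s<n. (y $ s - X $$ (s, pick (vars k l) j) * b j)\<^sup>2)) / (2 * \<sigma>\<^sup>2)))"
proof -
  let ?d = "msize k l" and ?q = "pick (vars k l)"
  note Xl = subdesign_carrier [OF X l]
  have fit: "(subdesign X l *\<^sub>v vec ?d b) $ s = (\<Sum>j<?d. X $$ (s, ?q j) * b j)" if "s < n" for s
    using that Xl by (auto simp: scalar_prod_def lessThan_atLeast0 subdesign_index [OF X l]
        intro!: sum.cong)
  have orth': "(\<Sum>s<n. X $$ (s, ?q i) * X $$ (s, ?q j)) = 0" if "i < ?d" "j < ?d" "i \<noteq> j" for i j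
  proof -
    have "?q i \<noteq> ?q j"
      using bij_betw_pick_vars [OF l] that by (auto simp: bij_betw_def inj_on_def)
    then have "(X\<^sup>T * X) $$ (?q i, ?q j) = 0"
      using orth X pick_vars(1) [OF l] that by (auto simp: diagonal_mat_def)
    then show ?thesis
      using X pick_vars(1) [OF l] that by (simp add: scalar_prod_def lessThan_atLeast0)
  qed
  have "likelihood X y \<sigma> l (vec ?d b) =
      (\<Prod>s<n. normal_density (\<Sum>j<?d. X $$ (s, ?q j) * b j) \<sigma> (y $ s))"
    unfolding likelihood_def using X y Xl \<sigma>
    by (subst mvn_density_diagonal)
      (auto simp: fit diagonal_mat_def simp del: index_mult_mat_vec intro!: prod.cong)
  also have "\<dots> = (\<Prod>s<n. normal_density 0 \<sigma> (y $ s)) *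
      (\<Prod>j<?d. exp (((\<Sum>s<n. (y $ s)\<^sup>2) - (\<Sum>s<n. (y $ s - X $$ (s, ?q j) * b j)\<^sup>2)) / (2 * \<sigma>\<^sup>2)))"
    using orth' by (rule orthogonal_regression_likelihood)
  finally show ?thesis .
qed

text \<open>
  Both the prior density and the likelihood are products over the coefficients, hence so is the
  integral. The constant in front is the density of the data under the model without variables.
\<close>

lemma marginal_factorizes:
  assumes X: "X \<in> carrier_mat n k" and y: "y \<in> carrier_vec n"
    and orth: "diagonal_mat (X\<^sup>T * X)"
    and l: "l \<in> models k" and \<mu>: "\<mu> \<in> carrier_vec k" and \<sigma>: "\<sigma> > 0"
    and \<Lambda>: "\<Lambda> \<in> carrier_mat k k" "diagonal_mat \<Lambda>" "\<forall>i<k. \<Lambda> $$ (i, i) > 0"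
  shows "marginal k X y \<mu> \<Lambda> \<sigma> l =
    (\<Prod>s<n. normal_density 0 \<sigma> (y $ s)) * (\<Prod>i<k. bayes_factor n X y \<mu> \<Lambda> \<sigma> i ^ l i)"
proof -
  let ?d = "msize k l" and ?q = "pick (vars k l)"
  let ?C = "\<Prod>s<n. normal_density 0 \<sigma> (y $ s)"
  let ?g = "\<lambda>j t. normal_density (\<mu> $ ?q j) (sqrt (\<sigma>\<^sup>2 * \<Lambda> $$ (?q j, ?q j))) t *
    exp (((\<Sum>s<n. (y $ s)\<^sup>2) - (\<Sum>s<n. (y $ s - X $$ (s, ?q j) * t)\<^sup>2)) / (2 * \<sigma>\<^sup>2))"
  interpret product_sigma_finite "\<lambda>_::nat. lborel :: real measure" ..
  have "marginal k X y \<mu> \<Lambda> \<sigma> l = (\<integral>b. ?C * (\<Prod>j<?d. ?g j (b j)) \<partial>(\<Pi>\<^sub>M j\<in>{..<?d}. lborel))"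
    unfolding marginal_def conj_prior_eq [OF l \<mu> \<sigma> \<Lambda>] likelihood_eq [OF X y orth l \<sigma>]
    by (simp add: prod.distrib mult_ac)
  also have "\<dots> = ?C * (\<integral>b. (\<Prod>j<?d. ?g j (b j)) \<partial>(\<Pi>\<^sub>M j\<in>{..<?d}. lborel))"
    by (rule integral_mult_right_zero)
  also have "(\<integral>b. (\<Prod>j<?d. ?g j (b j)) \<partial>(\<Pi>\<^sub>M j\<in>{..<?d}. lborel)) =
      (\<Prod>j<?d. bayes_factor n X y \<mu> \<Lambda> \<sigma> (?q j))"
    unfolding bayes_factor_def
    using \<sigma> \<Lambda>(3) pick_vars(1) [OF l]
    by (intro product_integral_prod finite_lessThan integrable_normal_density_times_likelihood_ratio) simp
  also have "\<dots> = (\<Prod>i\<in>vars k l. bayes_factor n X y \<mu> \<Lambda> \<sigma> i)"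
    by (rule prod.reindex_bij_betw [OF bij_betw_pick_vars [OF l]])
  also have "\<dots> = (\<Prod>i\<in>{..<k}. if l i = 1 then bayes_factor n X y \<mu> \<Lambda> \<sigma> i else 1)"
    by (subst prod.inter_filter [symmetric]) auto
  also have "\<dots> = (\<Prod>i<k. bayes_factor n X y \<mu> \<Lambda> \<sigma> i ^ l i)"
    using models_cases [OF l] by (intro prod.cong) force+
  finally show ?thesis .
qed

text \<open>
  Prior and marginal likelihood are both products over the variables, up to a constant. The
  normalizing constant \<open>Z\<close> is nonzero because the posterior probabilities, which are quotients
  by \<open>Z\<close>, sum to \<open>1\<close>.
\<close>

lemma model_posterior_product_of_incl_probs:
  assumes X: "X \<in> carrier_mat n k" and y: "y \<in> carrier_vec n"
    and conj: "indep_conj_case k X y \<mu> \<Lambda> \<sigma> prior p \<pi>"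
    and prior: "\<And>l. l \<in> models k \<Longrightarrow> prior l =
      (\<Prod>i<k. incl_prob k prior i ^ l i * (1 - incl_prob k prior i) ^ (1 - l i))"
    and probs: "model_probs k p"
    and l: "l \<in> models k"
  shows "p l = (\<Prod>i<k. incl_prob k p i ^ l i * (1 - incl_prob k p i) ^ (1 - l i))"
proof -
  define C where "C = (\<Prod>s<n. normal_density 0 \<sigma> (y $ s))"
  define Z where "Z = (\<Sum>l'\<in>models k. prior l' * marginal k X y \<mu> \<Lambda> \<sigma> l')"
  define h where "h i v = incl_prob k prior i ^ v * (1 - incl_prob k prior i) ^ (1 - v) *
    bayes_factor n X y \<mu> \<Lambda> \<sigma> i ^ v" for i v
  have "p l = C / Z * (\<Prod>i<k. h i (l i))" if l: "l \<in> models k" for l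
  proof -
    have "marginal k X y \<mu> \<Lambda> \<sigma> l = C * (\<Prod>i<k. bayes_factor n X y \<mu> \<Lambda> \<sigma> i ^ l i)"
      unfolding C_def using conj by (intro marginal_factorizes X y l) (auto simp: indep_conj_case_def)
    moreover have "p l = prior l * marginal k X y \<mu> \<Lambda> \<sigma> l / Z"
      using conj l by (simp add: indep_conj_case_def model_posterior_def Z_def)
    ultimately show ?thesis
      using prior [OF l] by (simp add: h_def prod.distrib)
  qed
  moreover have "(\<Sum>l\<in>models k. p l) = 1"
    using probs by (simp add: model_probs_def)
  ultimately show ?thesis
    using l by (rule normalized_product_weights_eq_incl_probs)
qed

theorem corollary1:
  fixes k n :: nat
    and X Q :: "real mat"
    and y :: "real vec"
    and p :: "(nat \<Rightarrow> nat) \<Rightarrow> real"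
    and \<pi> :: "(nat \<Rightarrow> nat) \<Rightarrow> ((nat \<Rightarrow> real) \<times> real) measure"
    and P :: "'w measure"
    and xstar :: "'w \<Rightarrow> real vec"
  assumes "k < n"
    and "X \<in> carrier_mat n k"
    and "vec_space.rank n X = k"
    and "y \<in> carrier_vec n"
    and "model_probs k p"
    and "\<And>l. l \<in> models k \<Longrightarrow> beta_sigma_distr (msize k l) (\<pi> l)"
    and "\<And>l. l \<in> models k \<Longrightarrow> has_beta_mean (msize k l) (\<pi> l)"
    and "prob_space P"
    and "\<And>\<omega>. \<omega> \<in> space P \<Longrightarrow> xstar \<omega> \<in> carrier_vec k"
    and "\<And>i. i < k \<Longrightarrow> (\<lambda>\<omega>. xstar \<omega> $ i) \<in> borel_measurable P"
    and "\<And>i j. i < k \<Longrightarrow> j < k \<Longrightarrow> integrable P (\<lambda>\<omega>. xstar \<omega> $ i * xstar \<omega> $ j)"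
    and "Q = second_moment k P xstar"
    and "pos_def_mat k Q"
    and "diagonal_mat Q"
    and "\<And>i. i < k \<Longrightarrow> Q $$ (i, i) > 0"
    and "\<And>l. l \<in> models k \<Longrightarrow>
           beta_tilde k \<pi> l = (Hmat k l)\<^sup>T *\<^sub>v beta_tilde k \<pi> (full_model k)"
  shows "is_arg_min (risk k p \<pi> Q) (\<lambda>l. l \<in> models k) (median_model k p) \<and>
    (\<forall>\<mu> \<Lambda> \<sigma> prior.
       indep_conj_case k X y \<mu> \<Lambda> \<sigma> prior p \<pi> \<and>
       (\<forall>l\<in>models k. prior l =
          (\<Prod>i<k. incl_prob k prior i ^ l i * (1 - incl_prob k prior i) ^ (1 - l i))) \<longrightarrow>
       (\<forall>l\<in>models k. p l =
          (\<Prod>i<k. incl_prob k p i ^ l i * (1 - incl_prob k p i) ^ (1 - l i))) \<and>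
       is_arg_max p (\<lambda>l. l \<in> models k) (median_model k p))"
proof (intro conjI allI impI)
  let ?b = "beta_tilde k \<pi> (full_model k)"
  have "?b \<in> carrier_vec k"
    by (simp add: beta_tilde_def beta_mean_def msize_def full_model_def)
  moreover have "Q \<in> carrier_mat k k"
    using assms(13) by (simp add: pos_def_mat_def)
  ultimately show "is_arg_min (risk k p \<pi> Q) (\<lambda>l. l \<in> models k) (median_model k p)"
    using assms(14-16) by (intro median_model_minimizes_risk [where b = ?b]) (auto intro: less_imp_le)
next
  fix \<mu> \<Lambda> \<sigma> prior
  assume "indep_conj_case k X y \<mu> \<Lambda> \<sigma> prior p \<pi> \<and>
    (\<forall>l\<in>models k. prior l =
      (\<Prod>i<k. incl_prob k prior i ^ l i * (1 - incl_prob k prior i) ^ (1 - l i)))"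
  then have product:
    "p l = (\<Prod>i<k. incl_prob k p i ^ l i * (1 - incl_prob k p i) ^ (1 - l i))"
    if "l \<in> models k" for l
    using that by (intro model_posterior_product_of_incl_probs [OF assms(2,4) _ _ assms(5)]) auto
  then show "\<forall>l\<in>models k.
      p l = (\<Prod>i<k. incl_prob k p i ^ l i * (1 - incl_prob k p i) ^ (1 - l i))"
    by blast
  show "is_arg_max p (\<lambda>l. l \<in> models k) (median_model k p)"
    using median_model_maximizes_product_weights [OF assms(5) product] .
qed

end
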